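(* Let $m\in\{1,5\}$, let $n\ge1$, and let $L(\phi)\in O(m,n)$ be a smooth local coset representative of $O(m,n)/(O(m)\times O(n))$. Let $L_{\Lambda r}$, $L_{\Lambda I}$, the vielbein $P_{rI}=P_{Ir}$ and the covariant derivative $\nabla$ be as in the context. For a constant vector $g=(g^\Lambda)\in\mathbb R^{m+n}$ put $$Z_r=L_{\Lambda r}\,g^\Lambda\quad(r=1,\dots,m),\qquad Z_I=L_{\Lambda I}\,g^\Lambda\quad(I=1,\dots,n).$$ Then $$\nabla Z_r=\sum_IZ_I\,P_{Ir},\qquad \nabla Z_I=\sum_rZ_r\,P_{rI},$$ $$\sum_rZ_rZ_r+\sum_IZ_IZ_I=g^\Lambda\,\mathcal N_{\Lambda\Sigma}\,g^\Sigma,\qquad \sum_rZ_rZ_r-\sum_IZ_IZ_I=g^\Lambda\,\eta_{\Lambda\Sigma}\,g^\Sigma,$$ where $\mathcal N_{\Lambda\Sigma}=\sum_rL_{\Lambda r}L_{\Sigma r}+\sum_IL_{\Lambda I}L_{\Sigma I}$.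
   Context: $\eta=\mathrm{diag}(\mathbf 1_m,-\mathbf 1_n)$, and $O(m,n)$ is the group of real matrices with $L^t\eta L=\eta$. The columns of $L$ are split as $L=(L^\Lambda{}_r,L^\Lambda{}_I)$ with $\Lambda=1,\dots,m+n$, $r=1,\dots,m$, $I=1,\dots,n$, and $L_{\Lambda r}=\eta_{\Lambda\Sigma}L^\Sigma{}_r$, $L_{\Lambda I}=\eta_{\Lambda\Sigma}L^\Sigma{}_I$. Repeated indices $\Lambda,\Sigma$ are summed. The left-invariant one-form has the block form $$L^{-1}dL=\begin{pmatrix}\omega_{sr}&P_{sI}\\P_{Jr}&\omega_{JI}\end{pmatrix},$$ where $\omega_{sr}$ and $\omega_{JI}$ (antisymmetric) are the $O(m)$ and $O(n)$ connections and $P_{rI}=P_{Ir}$ is the vielbein of the coset. The covariant derivatives are $\nabla V_r=dV_r-V_s\omega_{sr}$ and $\nabla V_I=dV_I-V_J\omega_{JI}$. (The case $m=5$ corresponds to $D=6$, $N=(4,0)$ supergravity and $m=1$ to the tensor-multiplet sector of $D=6$, $N=(2,0)$ supergravity, where $Z_1$ is written $Z$.) *)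

theory Defs
  imports "HOL-Analysis.Analysis"
begin

(* The index Lambda ranges over the type 'm + 'n: Inl r is the index r = 1..m, Inr I the
   index I = 1..n, where m = CARD('m) and n = CARD('n). *)

type_synonym ('m, 'n) block_matrix = "real ^ ('m + 'n) ^ ('m + 'n)"

definition eta :: "('m::finite, 'n::finite) block_matrix" where
  "eta = (\<chi> \<Lambda> \<Sigma>. if \<Lambda> = \<Sigma> then (case \<Lambda> of Inl _ \<Rightarrow> 1 | Inr _ \<Rightarrow> - 1) else 0)"

definition indefinite_orthogonal :: "('m::finite, 'n::finite) block_matrix set" where
  "indefinite_orthogonal = {L. transpose L ** eta ** L = eta}"

definition block_diag ::
  "real ^ 'm ^ 'm \<Rightarrow> real ^ 'n ^ 'n \<Rightarrow> ('m::finite, 'n::finite) block_matrix" where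
  "block_diag A B = (\<chi> \<Lambda> \<Sigma>. case (\<Lambda>, \<Sigma>) of
      (Inl r, Inl s) \<Rightarrow> A $ r $ s
    | (Inr I, Inr J) \<Rightarrow> B $ I $ J
    | _ \<Rightarrow> 0)"

definition isotropy_coset ::
  "('m::finite, 'n::finite) block_matrix \<Rightarrow> ('m, 'n) block_matrix set" where
  "isotropy_coset L =
     {L ** block_diag A B | A B. orthogonal_matrix A \<and> orthogonal_matrix B}"

(* C^k through iterated directional derivatives; on an open subset of a finite-dimensional
   space this is the usual notion. *)
primrec Ck_on ::
  "nat \<Rightarrow> 'a::real_normed_vector set \<Rightarrow> ('a \<Rightarrow> 'b::real_normed_vector) \<Rightarrow> bool" where
  "Ck_on 0 U f \<longleftrightarrow> continuous_on U f"
| "Ck_on (Suc k) U f \<longleftrightarrow>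
     (\<forall>x\<in>U. f differentiable (at x)) \<and>
     (\<forall>v. Ck_on k U (\<lambda>x. frechet_derivative f (at x) v))"

definition smooth_on ::
  "'a::real_normed_vector set \<Rightarrow> ('a \<Rightarrow> 'b::real_normed_vector) \<Rightarrow> bool" where
  "smooth_on U f \<longleftrightarrow> (\<forall>k. Ck_on k U f)"

(* L is a smooth local section of O(m,n) --> O(m,n)/(O(m) x O(n)), written in a coordinate
   system phi with open range U. That phi is a chart of the coset space is expressed upstairs:
   the union of the cosets of the L(phi) is open in O(m,n), distinct phi give distinct cosets,
   and the coordinate function x of a coset is smooth on that union, i.e. it is the restriction
   of a smooth function on an open set W of matrices. If U is nonempty, this forces
   DIM('a) = m n. *)
definition local_coset_representative ::
  "'a::euclidean_space set \<Rightarrow> ('a \<Rightarrow> ('m::finite, 'n::finite) block_matrix) \<Rightarrow> bool" where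
  "local_coset_representative U L \<longleftrightarrow>
     open U \<and> smooth_on U L \<and> (\<forall>\<phi>\<in>U. L \<phi> \<in> indefinite_orthogonal) \<and>
     (\<exists>W (x :: ('m, 'n) block_matrix \<Rightarrow> 'a).
        open W \<and> smooth_on W x \<and>
        W \<inter> indefinite_orthogonal = (\<Union>\<phi>\<in>U. isotropy_coset (L \<phi>)) \<and>
        (\<forall>\<phi>\<in>U. \<forall>h\<in>isotropy_coset (L \<phi>). x h = \<phi>))"

(* One-forms on U: the arguments phi and v are a point and a tangent vector at that point. *)

definition ext_d ::
  "('a::real_normed_vector \<Rightarrow> 'b::real_normed_vector) \<Rightarrow> 'a \<Rightarrow> 'a \<Rightarrow> 'b" where
  "ext_d f \<phi> v = frechet_derivative f (at \<phi>) v"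

definition left_invariant_form ::
  "('a::real_normed_vector \<Rightarrow> ('m::finite, 'n::finite) block_matrix) \<Rightarrow>
   'a \<Rightarrow> 'a \<Rightarrow> ('m, 'n) block_matrix" where
  "left_invariant_form L \<phi> v = matrix_inv (L \<phi>) ** ext_d L \<phi> v"

definition omega_m ::
  "('a::real_normed_vector \<Rightarrow> ('m::finite, 'n::finite) block_matrix) \<Rightarrow>
   'm \<Rightarrow> 'm \<Rightarrow> 'a \<Rightarrow> 'a \<Rightarrow> real" where
  "omega_m L s r \<phi> v = left_invariant_form L \<phi> v $ Inl s $ Inl r"

definition omega_n ::
  "('a::real_normed_vector \<Rightarrow> ('m::finite, 'n::finite) block_matrix) \<Rightarrow>
   'n \<Rightarrow> 'n \<Rightarrow> 'a \<Rightarrow> 'a \<Rightarrow> real" where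
  "omega_n L J I \<phi> v = left_invariant_form L \<phi> v $ Inr J $ Inr I"

(* P_{rI}, read off from the upper right block. P_{Ir} denotes the same form: the lower left
   block is the transpose, see left_invariant_form_lower_left. *)
definition vielbein ::
  "('a::real_normed_vector \<Rightarrow> ('m::finite, 'n::finite) block_matrix) \<Rightarrow>
   'm \<Rightarrow> 'n \<Rightarrow> 'a \<Rightarrow> 'a \<Rightarrow> real" where
  "vielbein L r I \<phi> v = left_invariant_form L \<phi> v $ Inl r $ Inr I"

definition nabla ::
  "('i::finite \<Rightarrow> 'i \<Rightarrow> 'a \<Rightarrow> 'a \<Rightarrow> real) \<Rightarrow>
   ('i \<Rightarrow> 'a::real_normed_vector \<Rightarrow> real) \<Rightarrow> 'i \<Rightarrow> 'a \<Rightarrow> 'a \<Rightarrow> real" where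
  "nabla \<omega> V i \<phi> v = ext_d (V i) \<phi> v - (\<Sum>j\<in>UNIV. V j \<phi> * \<omega> j i \<phi> v)"

definition lower ::
  "('m::finite, 'n::finite) block_matrix \<Rightarrow> ('m, 'n) block_matrix" where
  "lower L = (\<chi> \<Lambda> a. \<Sum>\<Sigma>\<in>UNIV. eta $ \<Lambda> $ \<Sigma> * L $ \<Sigma> $ a)"

definition Z_m ::
  "('a \<Rightarrow> ('m::finite, 'n::finite) block_matrix) \<Rightarrow> real ^ ('m + 'n) \<Rightarrow>
   'm \<Rightarrow> 'a \<Rightarrow> real" where
  "Z_m L g r \<phi> = (\<Sum>\<Lambda>\<in>UNIV. lower (L \<phi>) $ \<Lambda> $ Inl r * g $ \<Lambda>)"

definition Z_n ::
  "('a \<Rightarrow> ('m::finite, 'n::finite) block_matrix) \<Rightarrow> real ^ ('m + 'n) \<Rightarrow>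
   'n \<Rightarrow> 'a \<Rightarrow> real" where
  "Z_n L g I \<phi> = (\<Sum>\<Lambda>\<in>UNIV. lower (L \<phi>) $ \<Lambda> $ Inr I * g $ \<Lambda>)"

definition kinetic_matrix ::
  "('m::finite, 'n::finite) block_matrix \<Rightarrow> ('m, 'n) block_matrix" where
  "kinetic_matrix L = (\<chi> \<Lambda> \<Sigma>.
      (\<Sum>r\<in>UNIV. lower L $ \<Lambda> $ Inl r * lower L $ \<Sigma> $ Inl r) +
      (\<Sum>I\<in>UNIV. lower L $ \<Lambda> $ Inr I * lower L $ \<Sigma> $ Inr I))"

lemma eta_mult_component:
  fixes A :: "('m::finite, 'n::finite) block_matrix"
  shows "(eta ** A) $ i $ j = (case i of Inl _ \<Rightarrow> 1 | Inr _ \<Rightarrow> - 1) * A $ i $ j"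
proof -
  have "(eta ** A) $ i $ j =
      (\<Sum>k\<in>UNIV. if k = i then (case i of Inl _ \<Rightarrow> 1 | Inr _ \<Rightarrow> - 1) * A $ k $ j else 0)"
    unfolding eta_def matrix_matrix_mult_def vec_lambda_beta by (rule sum.cong) auto
  then show ?thesis
    by simp
qed

lemma eta_eta: "(eta :: ('m::finite, 'n::finite) block_matrix) ** eta = mat 1"
  unfolding vec_eq_iff eta_mult_component
  by (auto simp: eta_def mat_def split: sum.splits)

lemma transpose_eta: "transpose (eta :: ('m::finite, 'n::finite) block_matrix) = eta"
  by (simp add: eta_def transpose_def vec_eq_iff)

lemma left_invariant_form_eta_antisym:
  fixes L :: "'a::euclidean_space \<Rightarrow> ('m::finite, 'n::finite) block_matrix"
  assumes L: "local_coset_representative U L" and \<phi>: "\<phi> \<in> U"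
  shows "transpose (eta ** left_invariant_form L \<phi> v) = - (eta ** left_invariant_form L \<phi> v)"
proof -
  define B :: "('m, 'n) block_matrix \<Rightarrow> ('m, 'n) block_matrix \<Rightarrow> ('m, 'n) block_matrix"
    where "B X Y = transpose X ** eta ** Y" for X Y
  define D where "D = frechet_derivative L (at \<phi>)"
  have U: "open U" and O: "\<And>\<psi>. \<psi> \<in> U \<Longrightarrow> B (L \<psi>) (L \<psi>) = eta" and C: "Ck_on (Suc 0) U L"
    using L by (auto simp: local_coset_representative_def indefinite_orthogonal_def
        smooth_on_def B_def simp del: Ck_on.simps)
  have dL: "(L has_derivative D) (at \<phi>)"
    using C \<phi> by (simp add: D_def frechet_derivative_works [symmetric])
  have tr_add: "transpose (X + Y) = transpose X + transpose Y"
    and tr_scale: "transpose (c *\<^sub>R X) = c *\<^sub>R transpose X"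
    for X Y :: "('m, 'n) block_matrix" and c :: real
    by (simp_all add: transpose_def vec_eq_iff)
  have scaleR_matrix_left: "(c *\<^sub>R X) ** Y = c *\<^sub>R (X ** Y)"
    and add_matrix: "(X + Z) ** Y = X ** Y + Z ** Y"
    and scaleR_matrix_right: "X ** (c *\<^sub>R Y) = c *\<^sub>R (X ** Y)"
    for X Y Z :: "('m, 'n) block_matrix" and c :: real
    by (simp_all add: matrix_matrix_mult_def vec_eq_iff sum_distrib_left sum.distrib
        distrib_right mult.assoc mult.left_commute)
  have "bilinear B"
    unfolding bilinear_def B_def
    by (auto intro!: linearI simp: matrix_add_ldistrib add_matrix tr_add tr_scale
        scaleR_matrix_left scaleR_matrix_right)
  then have bb: "bounded_bilinear B"
    by (simp add: bilinear_conv_bounded_bilinear)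
  have "((\<lambda>\<psi>. B (L \<psi>) (L \<psi>)) has_derivative (\<lambda>h. B (L \<phi>) (D h) + B (D h) (L \<phi>))) (at \<phi>)"
    by (rule bounded_bilinear.FDERIV [OF bb dL dL])
  moreover have "((\<lambda>\<psi>. B (L \<psi>) (L \<psi>)) has_derivative (\<lambda>h. 0)) (at \<phi>)"
    by (rule has_derivative_transform_within_open [OF has_derivative_const U \<phi>]) (simp add: O)
  ultimately have "(\<lambda>h. B (L \<phi>) (D h) + B (D h) (L \<phi>)) = (\<lambda>h. 0)"
    by (rule has_derivative_unique)
  then have z: "B (L \<phi>) (D v) + B (D v) (L \<phi>) = 0"
    by meson
  have "(eta ** transpose (L \<phi>) ** eta) ** L \<phi> = eta ** B (L \<phi>) (L \<phi>)"
    by (simp add: B_def matrix_mul_assoc)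
  then have inv: "(eta ** transpose (L \<phi>) ** eta) ** L \<phi> = mat 1"
    by (simp add: O \<phi> eta_eta)
  then have inv': "L \<phi> ** (eta ** transpose (L \<phi>) ** eta) = mat 1"
    using matrix_left_right_inverse by blast
  have mi: "matrix_inv (L \<phi>) = eta ** transpose (L \<phi>) ** eta"
  proof -
    have "matrix_inv (L \<phi>) ** L \<phi> = mat 1"
      using someI_ex [of "\<lambda>A. L \<phi> ** A = mat 1 \<and> A ** L \<phi> = mat 1"] inv inv'
      unfolding matrix_inv_def by blast
    then have "matrix_inv (L \<phi>) ** (L \<phi> ** (eta ** transpose (L \<phi>) ** eta)) =
        eta ** transpose (L \<phi>) ** eta"
      by (metis matrix_mul_assoc matrix_mul_lid)
    then show ?thesis
      by (simp add: inv')
  qed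
  have e: "eta ** left_invariant_form L \<phi> v = B (L \<phi>) (D v)"
    by (simp add: left_invariant_form_def ext_d_def mi D_def B_def matrix_mul_assoc eta_eta)
  have "transpose (B (L \<phi>) (D v)) = B (D v) (L \<phi>)"
    by (simp add: B_def matrix_transpose_mul transpose_eta matrix_mul_assoc)
  then show ?thesis
    using z by (simp add: e eq_neg_iff_add_eq_0 add.commute)
qed

lemma
  fixes L :: "'a::euclidean_space \<Rightarrow> ('m::finite, 'n::finite) block_matrix"
  assumes "local_coset_representative U L" and "\<phi> \<in> U"
  shows left_invariant_form_lower_left:
      "left_invariant_form L \<phi> v $ Inr I $ Inl r = vielbein L r I \<phi> v"
    and omega_m_antisym: "omega_m L s r \<phi> v = - omega_m L r s \<phi> v"
    and omega_n_antisym: "omega_n L J I \<phi> v = - omega_n L I J \<phi> v"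
proof -
  have *: "(eta ** left_invariant_form L \<phi> v) $ j $ i = - (eta ** left_invariant_form L \<phi> v) $ i $ j"
    for i j
  proof -
    have "(eta ** left_invariant_form L \<phi> v) $ j $ i =
        transpose (eta ** left_invariant_form L \<phi> v) $ i $ j"
      by (simp only: transpose_def vec_lambda_beta)
    also have "\<dots> = - (eta ** left_invariant_form L \<phi> v) $ i $ j"
      by (simp only: left_invariant_form_eta_antisym [OF assms] vector_uminus_component)
    finally show ?thesis .
  qed
  show "left_invariant_form L \<phi> v $ Inr I $ Inl r = vielbein L r I \<phi> v"
    using * [of "Inr I" "Inl r"] by (simp add: eta_mult_component vielbein_def)
  show "omega_m L s r \<phi> v = - omega_m L r s \<phi> v"
    using * [of "Inl s" "Inl r"] by (simp add: eta_mult_component omega_m_def)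
  show "omega_n L J I \<phi> v = - omega_n L I J \<phi> v"
    using * [of "Inr J" "Inr I"] by (simp add: eta_mult_component omega_n_def)
qed

end

(* With Z = L^t eta g and dL = L (L^{-1} dL) one has dZ_a = sum_b Z_b (L^{-1} dL)_{ba}; the
   diagonal blocks of L^{-1} dL are the connection, so nabla Z keeps only the vielbein blocks.
   The quadratic identities are Z^t Z = g^t N g and Z^t eta Z = g^t eta L eta L^t eta g, where
   L eta L^t = eta because O(m,n) is closed under transposition. *)
theory Submission
  imports Defs
begin

lemma sum_UNIV_sum:
  fixes f :: "'m::finite + 'n::finite \<Rightarrow> 'b::comm_monoid_add"
  shows "sum f UNIV = (\<Sum>r\<in>UNIV. f (Inl r)) + (\<Sum>I\<in>UNIV. f (Inr I))"
  by (simp add: UNIV_Plus_UNIV [symmetric] sum.Plus del: UNIV_Plus_UNIV)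

lemma inner_matrix_vector_mult:
  fixes A :: "real ^ 'n ^ 'm"
  shows "x \<bullet> (A *v y) = (\<Sum>i\<in>UNIV. \<Sum>j\<in>UNIV. x $ i * A $ i $ j * y $ j)"
  by (simp add: inner_vec_def matrix_vector_mult_def sum_distrib_left mult.assoc)

lemma lower_eq_eta_mult: "lower L = eta ** L"
  by (simp add: lower_def matrix_matrix_mult_def)

lemma kinetic_matrix_eq: "kinetic_matrix L = lower L ** transpose (lower L)"
  by (simp add: kinetic_matrix_def matrix_matrix_mult_def transpose_def sum_UNIV_sum)

text \<open>Gathers the Z_r, and in \<open>Z_n_eq\<close> the Z_I, into the single row vector g^t
  eta L, so that both blocks can be differentiated and squared at once.\<close>

lemma Z_m_eq: "Z_m L g r \<phi> = (g v* lower (L \<phi>)) $ Inl r"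
  by (simp add: Z_m_def vector_matrix_mult_def mult.commute)

lemma Z_n_eq: "Z_n L g I \<phi> = (g v* lower (L \<phi>)) $ Inr I"
  by (simp add: Z_n_def vector_matrix_mult_def mult.commute)

text \<open>Multiplying L^t eta L = eta by eta from the left gives a left inverse, since eta squares
  to 1; for square matrices it is also a right inverse.\<close>

lemma indefinite_orthogonal_inverse:
  assumes "L \<in> indefinite_orthogonal"
  shows "(eta ** transpose L ** eta) ** L = mat 1"
    and "L ** (eta ** transpose L ** eta) = mat 1"
proof -
  have "(eta ** transpose L ** eta) ** L = eta ** (transpose L ** eta ** L)"
    by (simp add: matrix_mul_assoc)
  with assms show inv: "(eta ** transpose L ** eta) ** L = mat 1"
    by (simp add: indefinite_orthogonal_def eta_eta)
  then show "L ** (eta ** transpose L ** eta) = mat 1"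
    using matrix_left_right_inverse by blast
qed

lemma indefinite_orthogonal_transpose:
  assumes "L \<in> indefinite_orthogonal"
  shows "L ** eta ** transpose L = eta"
proof -
  have "L ** eta ** transpose L = L ** (eta ** transpose L ** eta) ** eta"
    by (simp add: matrix_mul_assoc [symmetric] eta_eta)
  then show ?thesis
    by (simp add: indefinite_orthogonal_inverse(2) [OF assms])
qed

text \<open>\<open>matrix_inv\<close> is a choice operator, so its defining property has to be drawn
  from the explicit two-sided inverse above.\<close>

lemma indefinite_orthogonal_mult_matrix_inv:
  assumes "L \<in> indefinite_orthogonal"
  shows "L ** matrix_inv L = mat 1"
  unfolding matrix_inv_def
  using someI_ex [of "\<lambda>A. L ** A = mat 1 \<and> A ** L = mat 1"]
    indefinite_orthogonal_inverse [OF assms]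
  by blast

text \<open>Each component of g^t eta L is a fixed linear functional of L, so d passes through it
  and acts on L alone.\<close>

lemma ext_d_vector_mult_lower:
  fixes L :: "'a::euclidean_space \<Rightarrow> ('m::finite, 'n::finite) block_matrix"
  assumes L: "local_coset_representative U L" and \<phi>: "\<phi> \<in> U"
  shows "ext_d (\<lambda>\<psi>. (g v* lower (L \<psi>)) $ a) \<phi> v =
    (\<Sum>b\<in>UNIV. (g v* lower (L \<phi>)) $ b * left_invariant_form L \<phi> v $ b $ a)"
proof -
  define D where "D = frechet_derivative L (at \<phi>)"
  have C: "Ck_on (Suc 0) U L" and O: "L \<phi> \<in> indefinite_orthogonal"
    using L \<phi> by (auto simp: local_coset_representative_def smooth_on_def simp del: Ck_on.simps)
  have dL: "(L has_derivative D) (at \<phi>)"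
    using C \<phi> by (simp add: D_def frechet_derivative_works [symmetric])
  have "linear (\<lambda>X :: ('m, 'n) block_matrix. (g v* (eta ** X)) $ a)"
    by (rule linearI)
      (simp_all add: vector_matrix_mult_def matrix_matrix_mult_def algebra_simps sum.distrib
        sum_distrib_left)
  then have "bounded_linear (\<lambda>X :: ('m, 'n) block_matrix. (g v* (eta ** X)) $ a)"
    by (simp add: linear_conv_bounded_linear)
  from bounded_linear.has_derivative [OF this dL]
  have "ext_d (\<lambda>\<psi>. (g v* lower (L \<psi>)) $ a) \<phi> v = (g v* (eta ** D v)) $ a"
    unfolding ext_d_def lower_eq_eta_mult by (metis frechet_derivative_at)
  \<comment> \<open>Inserting L L^{-1} = 1 expresses dL through the left-invariant form and so
    brings back the undifferentiated Z.\<close>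
  also have "D v = L \<phi> ** left_invariant_form L \<phi> v"
    by (simp add: left_invariant_form_def ext_d_def D_def matrix_mul_assoc
        indefinite_orthogonal_mult_matrix_inv [OF O])
  also have "g v* (eta ** (L \<phi> ** left_invariant_form L \<phi> v)) =
      (g v* lower (L \<phi>)) v* left_invariant_form L \<phi> v"
    by (simp add: lower_eq_eta_mult matrix_mul_assoc vector_matrix_mul_assoc)
  finally show ?thesis
    by (simp add: vector_matrix_mult_def [of _ "left_invariant_form L \<phi> v"])
qed

text \<open>With M = \<open>lower L\<close> the kinetic matrix is M M^t, and M moves across the
  inner product as its transpose.\<close>

lemma vector_mult_lower_kinetic:
  "(g v* lower L) \<bullet> (g v* lower L) = g \<bullet> (kinetic_matrix L *v g)"
  by (simp add: dot_lmul_matrix kinetic_matrix_eq matrix_vector_mul_assoc [symmetric])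

lemma vector_mult_lower_eta:
  assumes "L \<in> indefinite_orthogonal"
  shows "(g v* lower L) \<bullet> (eta *v (g v* lower L)) = g \<bullet> (eta *v g)"
proof -
  have "(g v* lower L) \<bullet> (eta *v (g v* lower L)) =
      g \<bullet> ((lower L ** eta ** transpose (lower L)) *v g)"
    by (simp add: dot_lmul_matrix matrix_vector_mul_assoc [symmetric])
  \<comment> \<open>Each lowered factor contributes an outer eta; once L eta L^t has become eta,
    three etas remain and collapse to one.\<close>
  also have "lower L ** eta ** transpose (lower L) = eta ** (L ** eta ** transpose L) ** eta"
    by (simp add: lower_eq_eta_mult matrix_transpose_mul transpose_eta matrix_mul_assoc)
  also have "\<dots> = eta"
    by (simp add: indefinite_orthogonal_transpose [OF assms] eta_eta)
  finally show ?thesis .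
qed

lemma inner_eta:
  fixes x :: "real ^ ('m::finite + 'n::finite)"
  shows "x \<bullet> (eta *v x) =
    (\<Sum>r\<in>UNIV. x $ Inl r * x $ Inl r) - (\<Sum>I\<in>UNIV. x $ Inr I * x $ Inr I)"
proof -
  have "(eta *v x) $ i = (case i of Inl _ \<Rightarrow> 1 | Inr _ \<Rightarrow> - 1) * x $ i" for i
    unfolding eta_def matrix_vector_mult_def vec_lambda_beta
    by (simp add: if_distrib [of "\<lambda>y. y * _"] cong: if_cong)
  then show ?thesis
    by (simp add: inner_vec_def sum_UNIV_sum sum_negf)
qed

theorem mainTheorem3:
  fixes L :: "'a::euclidean_space \<Rightarrow> ('m::finite, 'n::finite) block_matrix"
    and U :: "'a set"
    and g :: "real ^ ('m + 'n)"
  assumes "CARD('m) \<in> {1, 5}"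
    and "local_coset_representative U L"
    and "\<phi> \<in> U"
  shows "(\<forall>r v. nabla (omega_m L) (Z_m L g) r \<phi> v =
              (\<Sum>I\<in>UNIV. Z_n L g I \<phi> * vielbein L r I \<phi> v)) \<and>
    (\<forall>I v. nabla (omega_n L) (Z_n L g) I \<phi> v =
              (\<Sum>r\<in>UNIV. Z_m L g r \<phi> * vielbein L r I \<phi> v)) \<and>
    (\<Sum>r\<in>UNIV. Z_m L g r \<phi> * Z_m L g r \<phi>) + (\<Sum>I\<in>UNIV. Z_n L g I \<phi> * Z_n L g I \<phi>) =
      (\<Sum>\<Lambda>\<in>UNIV. \<Sum>\<Sigma>\<in>UNIV. g $ \<Lambda> * kinetic_matrix (L \<phi>) $ \<Lambda> $ \<Sigma> * g $ \<Sigma>) \<and>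
    (\<Sum>r\<in>UNIV. Z_m L g r \<phi> * Z_m L g r \<phi>) - (\<Sum>I\<in>UNIV. Z_n L g I \<phi> * Z_n L g I \<phi>) =
      (\<Sum>\<Lambda>\<in>UNIV. \<Sum>\<Sigma>\<in>UNIV. g $ \<Lambda> * eta $ \<Lambda> $ \<Sigma> * g $ \<Sigma>)"
proof -
  define Z where "Z = g v* lower (L \<phi>)"
  note L = assms(2) and \<phi> = assms(3)
  have O: "L \<phi> \<in> indefinite_orthogonal"
    using L \<phi> by (simp add: local_coset_representative_def)
  have d: "ext_d (Z_m L g r) \<phi> v = (\<Sum>b\<in>UNIV. Z $ b * left_invariant_form L \<phi> v $ b $ Inl r)"
    "ext_d (Z_n L g I) \<phi> v = (\<Sum>b\<in>UNIV. Z $ b * left_invariant_form L \<phi> v $ b $ Inr I)"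
    for r I v
    using ext_d_vector_mult_lower [OF L \<phi>, of g]
    unfolding Z_def Z_m_eq [abs_def] Z_n_eq [abs_def] by simp_all
  \<comment> \<open>The \<open>Inl\<close> part of the sum over b cancels the connection term. What
    is left is the lower left block, which is the vielbein only because eta L^{-1} dL is
    antisymmetric.\<close>
  have "nabla (omega_m L) (Z_m L g) r \<phi> v = (\<Sum>I\<in>UNIV. Z_n L g I \<phi> * vielbein L r I \<phi> v)"
    for r v
    by (simp add: nabla_def d sum_UNIV_sum Z_m_eq Z_n_eq Z_def [symmetric] omega_m_def
        left_invariant_form_lower_left [OF L \<phi>])
  \<comment> \<open>Now the \<open>Inr\<close> part cancels, and the upper right block left over is
    the vielbein by definition.\<close>
  moreover have "nabla (omega_n L) (Z_n L g) I \<phi> v =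
      (\<Sum>r\<in>UNIV. Z_m L g r \<phi> * vielbein L r I \<phi> v)" for I v
    by (simp add: nabla_def d sum_UNIV_sum Z_m_eq Z_n_eq Z_def [symmetric] omega_n_def
        vielbein_def)
  moreover have "(\<Sum>r\<in>UNIV. Z_m L g r \<phi> * Z_m L g r \<phi>) + (\<Sum>I\<in>UNIV. Z_n L g I \<phi> * Z_n L g I \<phi>) =
      (\<Sum>\<Lambda>\<in>UNIV. \<Sum>\<Sigma>\<in>UNIV. g $ \<Lambda> * kinetic_matrix (L \<phi>) $ \<Lambda> $ \<Sigma> * g $ \<Sigma>)"
    using vector_mult_lower_kinetic [of g "L \<phi>"]
    unfolding inner_matrix_vector_mult
    \<comment> \<open>The instance of \<open>sum_UNIV_sum\<close> splits the sum of squares of Z and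
      leaves the sums over \<Lambda> and \<Sigma> whole.\<close>
    by (simp add: inner_vec_def sum_UNIV_sum [of "\<lambda>i. (g v* _) $ i * _ i"] Z_m_eq Z_n_eq)
  moreover have "(\<Sum>r\<in>UNIV. Z_m L g r \<phi> * Z_m L g r \<phi>) - (\<Sum>I\<in>UNIV. Z_n L g I \<phi> * Z_n L g I \<phi>) =
      (\<Sum>\<Lambda>\<in>UNIV. \<Sum>\<Sigma>\<in>UNIV. g $ \<Lambda> * eta $ \<Lambda> $ \<Sigma> * g $ \<Sigma>)"
    using vector_mult_lower_eta [OF O, of g] inner_eta [of "g v* lower (L \<phi>)"]
    \<comment> \<open>Fixing g as the left vector expands only the right-hand quadratic form; the
      form in Z is left for \<open>inner_eta\<close>.\<close>
    by (simp add: Z_m_eq Z_n_eq inner_matrix_vector_mult [of g])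
  ultimately show ?thesis
    by blast
qed

end
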